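(* Let $X$ be a separable quasi-Banach space over $\mathbb{F}\in\{\mathbb{R},\mathbb{C}\}$, and let $N=(X^* )^\perp=\{x\in X\colon x^*(x)=0 \text{ for all } x^*\in X^*\}$. Suppose that $N\neq\{0\}$ and that $X/N$ is infinite-dimensional. Let $J_X\colon X\to\widehat{X}$ be the envelope map of $X$ into its Banach envelope. Then: (i) $J_X$ is not one-to-one, and (ii) there exists a dense linear subspace $X_0\subseteq X$ such that the restriction of $J_X$ to $X_0$ is one-to-one.
   Context: A quasi-Banach space is a complete quasi-normed vector space over $\mathbb{F}$; $X^*$ denotes the space of continuous linear functionals on $X$. The Banach envelope of a quasi-Banach space $(X,\|\cdot\|)$ is constructed as follows. For $x\in X$ put $\|x\|_e=\inf\{\sum_{i=1}^n\|x_i\|\colon n\in\mathbb{N},\ x_i\in X,\ \sum_{i=1}^n x_i=x\}$, which is a seminorm on $X$ (the Minkowski functional of the convex hull of the closed unit ball of $X$). Its null space $\{x\colon\|x\|_e=0\}$ equals $(X^* )^\perp$. The Banach envelope $\widehat{X}$ is the completion of the normed space $X/(X^* )^\perp$ equipped with the norm induced by $\|\cdot\|_e$, and the envelope map $J_X\colon X\to\widehat{X}$ is the quotient map $X\to X/(X^* )^\perp$ followed by the inclusion into $\widehat{X}$. Equivalently, $(\widehat{X},J_X)$ is characterized by the universal property: for every Banach space $Y$ and every continuous linear $T\colon X\to Y$ there is a unique continuous linear $\widehat{T}\colon\widehat{X}\to Y$ with $\widehat{T}\circ J_X=T$, and $\|\widehat{T}\|\le\|T\|$. *)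

theory Defs
  imports "HOL-Analysis.Analysis"
begin

text \<open>
  The scalar field is a type \<open>'k\<close> of class \<^class>\<open>real_normed_field\<close>. By the theorem of
  Gelfand and Mazur such a field is isometrically isomorphic to the reals or to the complex
  numbers, so this is the usual assumption that the scalars are real or complex.

  A quasi-norm \<open>q\<close> is in general not a metric and need not be continuous, so the space carries no
  topological type class: it is a vector space \<open>s\<close> in the sense of \<^locale>\<open>vector_space\<close> together
  with a function \<open>q\<close>, and its topology is an explicit value of type \<open>'a topology\<close>.
\<close>

definition quasi_norm ::
  "('k::real_normed_field \<Rightarrow> 'a::ab_group_add \<Rightarrow> 'a) \<Rightarrow> ('a \<Rightarrow> real) \<Rightarrow> bool" where
  "quasi_norm s q \<longleftrightarrow>
     (\<forall>x. 0 \<le> q x) \<and>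
     (\<forall>x. q x = 0 \<longleftrightarrow> x = 0) \<and>
     (\<forall>c x. q (s c x) = norm c * q x) \<and>
     (\<exists>K\<ge>1. \<forall>x y. q (x + y) \<le> K * (q x + q y))"

definition quasi_complete :: "('a::ab_group_add \<Rightarrow> real) \<Rightarrow> bool" where
  "quasi_complete q \<longleftrightarrow>
     (\<forall>x :: nat \<Rightarrow> 'a.
        (\<forall>e>0. \<exists>M. \<forall>m\<ge>M. \<forall>n\<ge>M. q (x m - x n) < e) \<longrightarrow>
        (\<exists>l. (\<lambda>n. q (x n - l)) \<longlonglongrightarrow> 0))"

definition quasi_banach_space ::
  "('k::real_normed_field \<Rightarrow> 'a::ab_group_add \<Rightarrow> 'a) \<Rightarrow> ('a \<Rightarrow> real) \<Rightarrow> bool" where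
  "quasi_banach_space s q \<longleftrightarrow> vector_space s \<and> quasi_norm s q \<and> quasi_complete q"

text \<open>
  The sets \<open>{y. q (y - x) < e}\<close> need not be open in this topology, but they form a base of
  neighbourhoods of \<open>x\<close>.
\<close>

definition quasi_topology :: "('a::ab_group_add \<Rightarrow> real) \<Rightarrow> 'a topology" where
  "quasi_topology q = topology (\<lambda>U. \<forall>x\<in>U. \<exists>e>0. \<forall>y. q (y - x) < e \<longrightarrow> y \<in> U)"

lemma openin_quasi_topology:
  "openin (quasi_topology q) U \<longleftrightarrow> (\<forall>x\<in>U. \<exists>e>0. \<forall>y. q (y - x) < e \<longrightarrow> y \<in> U)"
proof -
  have "istopology (\<lambda>U. \<forall>x\<in>U. \<exists>e>0. \<forall>y. q (y - x) < e \<longrightarrow> y \<in> U)"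
    unfolding istopology_def
  proof (intro conjI allI impI ballI)
    fix S T x
    assume S: "\<forall>x\<in>S. \<exists>e>0. \<forall>y. q (y - x) < e \<longrightarrow> y \<in> S"
      and T: "\<forall>x\<in>T. \<exists>e>0. \<forall>y. q (y - x) < e \<longrightarrow> y \<in> T" and x: "x \<in> S \<inter> T"
    obtain d where "d > 0" "\<forall>y. q (y - x) < d \<longrightarrow> y \<in> S" using S x by blast
    moreover obtain e where "e > 0" "\<forall>y. q (y - x) < e \<longrightarrow> y \<in> T" using T x by blast
    ultimately show "\<exists>e>0. \<forall>y. q (y - x) < e \<longrightarrow> y \<in> S \<inter> T"
      by (intro exI[of _ "min d e"]) auto
  next
    fix \<U> x
    assume "\<forall>S\<in>\<U>. \<forall>x\<in>S. \<exists>e>0. \<forall>y. q (y - x) < e \<longrightarrow> y \<in> S" "x \<in> \<Union>\<U>"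
    then show "\<exists>e>0. \<forall>y. q (y - x) < e \<longrightarrow> y \<in> \<Union>\<U>" by (meson UnionE UnionI)
  qed
  then show ?thesis by (simp add: quasi_topology_def topology_inverse')
qed

lemma topspace_quasi_topology [simp]: "topspace (quasi_topology q) = UNIV"
proof -
  have "openin (quasi_topology q) UNIV"
    unfolding openin_quasi_topology using zero_less_one by blast
  then show ?thesis using openin_subset by blast
qed

definition dual_space ::
  "('k::real_normed_field \<Rightarrow> 'a::ab_group_add \<Rightarrow> 'a) \<Rightarrow> ('a \<Rightarrow> real) \<Rightarrow> ('a \<Rightarrow> 'k) set" where
  "dual_space s q =
     {f. Vector_Spaces.linear s (*) f \<and> continuous_map (quasi_topology q) euclidean f}"

definition dual_annihilator ::
  "('k::real_normed_field \<Rightarrow> 'a::ab_group_add \<Rightarrow> 'a) \<Rightarrow> ('a \<Rightarrow> real) \<Rightarrow> 'a set" where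
  "dual_annihilator s q = {x. \<forall>f \<in> dual_space s q. f x = 0}"

text \<open>
  The quotient by a subspace \<open>N\<close> is the set of cosets \<open>x + N\<close>. Sums of cosets, including finite
  sums, are the Minkowski sums of \<^theory>\<open>HOL-Library.Set_Algebras\<close>, whose neutral element is
  \<open>{0}\<close>. The zero of the quotient being \<open>N\<close> instead, \<open>N\<close> is added where a sum can be empty or a
  scalar can vanish.
\<close>

definition quotient_space :: "'a::ab_group_add set \<Rightarrow> 'a set set" where
  "quotient_space N = range (\<lambda>x. x +o N)"

definition quotient_scale ::
  "('k \<Rightarrow> 'a::ab_group_add \<Rightarrow> 'a) \<Rightarrow> 'a set \<Rightarrow> 'k \<Rightarrow> 'a set \<Rightarrow> 'a set" where
  "quotient_scale s N c A = s c ` A + N"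

definition finite_dimensional_quotient ::
  "('k::field \<Rightarrow> 'a::ab_group_add \<Rightarrow> 'a) \<Rightarrow> 'a set \<Rightarrow> bool" where
  "finite_dimensional_quotient s N \<longleftrightarrow>
     (\<exists>\<B> \<subseteq> quotient_space N. finite \<B> \<and>
        (\<forall>A \<in> quotient_space N. \<exists>c. A = (\<Sum>B\<in>\<B>. quotient_scale s N (c B) B) + N))"

definition envelope_seminorm :: "('a::ab_group_add \<Rightarrow> real) \<Rightarrow> 'a \<Rightarrow> real" where
  "envelope_seminorm q x = Inf {(\<Sum>i<n. q (y i)) | (n::nat) y. (\<Sum>i<n. y i) = x}"

text \<open>
  The class \<^class>\<open>banach\<close> provides the norm, its completeness and the real scalar
  multiplication; the multiplication \<open>t\<close> by scalars in \<open>'k\<close> has to extend the latter.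
\<close>

definition banach_scale ::
  "('k::real_normed_field \<Rightarrow> 'e::banach \<Rightarrow> 'e) \<Rightarrow> bool" where
  "banach_scale t \<longleftrightarrow>
     vector_space t \<and>
     (\<forall>r v. t (of_real r) v = r *\<^sub>R v) \<and>
     (\<forall>c v. norm (t c v) = norm c * norm v)"

text \<open>
  The next predicate says that \<open>\<iota>\<close> is a linear isometry with dense range from the quotient by the
  annihilator \<open>N\<close> of the dual, normed by the envelope seminorm of any representative, into the
  Banach space \<open>'e\<close>; that is, \<open>('e, \<iota>)\<close> is a completion of this quotient. Completions are unique
  up to isometric isomorphism only, so the envelope and its map \<open>J\<close> are specified by a predicate
  instead of one particular model.
\<close>

definition quotient_completion ::
  "('k::real_normed_field \<Rightarrow> 'a::ab_group_add \<Rightarrow> 'a) \<Rightarrow> ('a \<Rightarrow> real) \<Rightarrow>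
   ('k \<Rightarrow> 'e::banach \<Rightarrow> 'e) \<Rightarrow> ('a set \<Rightarrow> 'e) \<Rightarrow> bool" where
  "quotient_completion s q t \<iota> \<longleftrightarrow>
     (let N = dual_annihilator s q; Q = quotient_space N in
        banach_scale t \<and>
        (\<forall>A\<in>Q. \<forall>B\<in>Q. \<iota> (A + B) = \<iota> A + \<iota> B) \<and>
        (\<forall>c. \<forall>A\<in>Q. \<iota> (quotient_scale s N c A) = t c (\<iota> A)) \<and>
        (\<forall>A\<in>Q. \<forall>x\<in>A. norm (\<iota> A) = envelope_seminorm q x) \<and>
        closure (\<iota> ` Q) = UNIV)"

definition banach_envelope_map ::
  "('k::real_normed_field \<Rightarrow> 'a::ab_group_add \<Rightarrow> 'a) \<Rightarrow> ('a \<Rightarrow> real) \<Rightarrow>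
   ('k \<Rightarrow> 'e::banach \<Rightarrow> 'e) \<Rightarrow> ('a \<Rightarrow> 'e) \<Rightarrow> bool" where
  "banach_envelope_map s q t J \<longleftrightarrow>
     (\<exists>\<iota>. quotient_completion s q t \<iota> \<and> J = (\<lambda>x. \<iota> (x +o dual_annihilator s q)))"

end

theory Submission
  imports Defs
begin

text \<open>
  The kernel of \<open>J\<close> is \<open>N\<close>, since every functional in the dual is dominated by a multiple of the
  envelope seminorm. It remains to find a dense subspace meeting \<open>N\<close> only in \<open>0\<close>. Let
  \<open>(d\<^sub>i)\<close> be dense. A proper subspace contains no ball, and \<open>N + span {x\<^sub>0, \<dots>, x\<^sub>n\<^sub>-\<^sub>1}\<close> is always
  proper because \<open>X / N\<close> has infinite dimension. Enumerating the pairs \<open>(i, j)\<close>, one can therefore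
  choose for the \<open>n\<close>-th pair a vector \<open>x\<^sub>n\<close> outside this subspace at distance less than
  \<open>1 / (j + 1)\<close> from \<open>d\<^sub>i\<close>. The span of all \<open>x\<^sub>n\<close> is dense and meets \<open>N\<close> trivially.
\<close>

section \<open>Linear independence modulo a subspace\<close>

text \<open>If a combination of \<open>x 0, ..., x n\<close> lies in \<open>N\<close>, the
  coefficient of \<open>x n\<close> must vanish, since dividing by it would put \<open>x n\<close>
  into the span of \<open>N\<close> and the earlier vectors. Induction then removes all
  coefficients.\<close>

lemma (in vector_space) span_Int_subspace_trivial:
  fixes x :: "nat \<Rightarrow> 'b"
  assumes "subspace N" and x: "\<And>n. x n \<notin> span (N \<union> x ` {..<n})"
  shows "span (range x) \<inter> N = {0}"
proof -
  have fin: "v = 0" if "v \<in> span (x ` {..<n})" "v \<in> N" for n v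
    using that
  proof (induction n)
    case 0
    then show ?case by simp
  next
    case (Suc n)
    obtain k where k: "v - scale k (x n) \<in> span (x ` {..<n})"
      using Suc.prems(1) by (auto simp: lessThan_Suc span_insert)
    have kx: "scale k (x n) \<in> span (N \<union> x ` {..<n})"
    proof -
      have "v \<in> span (N \<union> x ` {..<n})" using Suc.prems(2) by (simp add: span_base)
      moreover have "v - scale k (x n) \<in> span (N \<union> x ` {..<n})"
        using k span_mono[of "x ` {..<n}" "N \<union> x ` {..<n}"] by blast
      ultimately have "v - (v - scale k (x n)) \<in> span (N \<union> x ` {..<n})" by (rule span_diff)
      then show ?thesis by simp
    qed
    have "k = 0"
    proof (rule ccontr)
      assume "k \<noteq> 0"
      then have "x n = scale (inverse k) (scale k (x n))" by simp
      then show False using span_scale[OF kx, of "inverse k"] x by simp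
    qed
    then show ?case using k Suc by simp
  qed
  have "v = 0" if v: "v \<in> span (range x)" "v \<in> N" for v
  proof -
    \<comment> \<open>A vector of the span uses only finitely many \<open>x i\<close>, hence lies in
      the span of an initial segment.\<close>
    obtain S where S: "finite S" "S \<subseteq> range x" "v \<in> span S"
      using v(1) by (auto simp: span_explicit intro!: span_sum span_scale span_base)
    then obtain I where I: "finite I" "S = x ` I" by (meson finite_subset_image)
    then obtain n where "I \<subseteq> {..<n}" using finite_nat_iff_bounded by blast
    then have "v \<in> span (x ` {..<n})" using S I span_mono[of S "x ` {..<n}"] by blast
    then show ?thesis using fin v by blast
  qed
  then show ?thesis using assms(1) by (auto simp: span_zero subspace_0)
qed

section \<open>Arithmetic of cosets and dimension of the quotient\<close>

lemma coset_eq_iff: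
  assumes "vector_space s" "module.subspace s N"
  shows "x +o N = y +o N \<longleftrightarrow> x - y \<in> N"
proof -
  interpret vector_space s by fact
  note [simp] = subspace_0[OF assms(2)]
  show ?thesis
  proof
    assume "x +o N = y +o N"
    moreover have "x \<in> x +o N" by (auto simp: elt_set_plus_def)
    ultimately show "x - y \<in> N" by (auto simp: elt_set_plus_def)
  next
    assume xy: "x - y \<in> N"
    have sub: "a +o N \<subseteq> b +o N" if "a - b \<in> N" for a b
    proof
      fix z assume "z \<in> a +o N"
      then obtain n where n: "n \<in> N" "z = a + n" by (auto simp: elt_set_plus_def)
      then have "z = b + ((a - b) + n)" by simp
      then show "z \<in> b +o N"
        using subspace_add[OF assms(2) that n(1)] unfolding elt_set_plus_def by blast
    qed
    have "y - x \<in> N" using subspace_neg[OF assms(2) xy] by simp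
    with xy show "x +o N = y +o N" using sub by blast
  qed
qed

lemma coset_add:
  assumes "vector_space s" "module.subspace s N"
  shows "(x +o N) + (y +o N) = (x + y) +o N"
proof -
  interpret vector_space s by fact
  have "N + N = N"
  proof
    show "N + N \<subseteq> N" using subspace_add[OF assms(2)] by (auto simp: set_plus_def)
    show "N \<subseteq> N + N"
      using subspace_0[OF assms(2)] by (rule set_zero_plus2)
  qed
  then show ?thesis by (simp add: set_plus_rearranges ac_simps)
qed

lemma quotient_scale_coset:
  assumes "vector_space s" "module.subspace s N"
  shows "quotient_scale s N c (x +o N) = s c x +o N"
proof -
  interpret vector_space s by fact
  note sub = assms(2)
  show ?thesis
  proof
    show "quotient_scale s N c (x +o N) \<subseteq> s c x +o N"
      using subspace_add[OF sub] subspace_scale[OF sub]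
      by (fastforce simp: quotient_scale_def set_plus_def elt_set_plus_def scale_right_distrib add.assoc)
    show "s c x +o N \<subseteq> quotient_scale s N c (x +o N)"
    proof
      fix z assume "z \<in> s c x +o N"
      then obtain n where "n \<in> N" "z = s c x + n" by (auto simp: elt_set_plus_def)
      \<comment> \<open>Scaling the single representative \<open>x\<close> and taking
        \<open>n\<close> from the added summand \<open>N\<close> also covers \<open>c = 0\<close>,
        where the image of the coset is only \<open>{0}\<close>.\<close>
      moreover have "x \<in> x +o N" using subspace_0[OF sub] by (auto simp: elt_set_plus_def)
      ultimately show "z \<in> quotient_scale s N c (x +o N)"
        unfolding quotient_scale_def by blast
    qed
  qed
qed

lemma sum_quotient_scale_cosets:
  assumes "vector_space s" "module.subspace s N" "finite \<B>"
    and "\<And>B. B \<in> \<B> \<Longrightarrow> B = r B +o N"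
  shows "(\<Sum>B\<in>\<B>. quotient_scale s N (c B) B) + N = (\<Sum>B\<in>\<B>. s (c B) (r B)) +o N"
  using assms(3,4)
proof (induction \<B> rule: finite_induct)
  case empty
  then show ?case by simp
next
  case (insert B \<B>)
  have "quotient_scale s N (c B) B = s (c B) (r B) +o N"
    using insert.prems[of B] quotient_scale_coset[OF assms(1,2), of "c B" "r B"] by simp
  then show ?case
    using insert by (simp add: add.assoc coset_add[OF assms(1,2)])
qed

text \<open>The cosets of the vectors in \<open>F\<close> span the quotient. Used in contrapositive
  form: if the quotient has infinite dimension, \<open>N\<close> together with finitely many vectors
  never spans the whole space.\<close>

lemma finite_dimensional_quotient_if_span:
  assumes "vector_space s" "module.subspace s N" "finite F" "module.span s (N \<union> F) = UNIV"
  shows "finite_dimensional_quotient s N"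
proof -
  interpret vector_space s by fact
  note sub = assms(2)
  define \<B> where "\<B> = (\<lambda>f. f +o N) ` F"
  \<comment> \<open>Several vectors of \<open>F\<close> may share a coset, whereas the sum to be
    found has one term per coset. So \<open>F\<close> is replaced by one representative
    \<open>r B\<close> of each coset, which alters its vectors only by elements of
    \<open>N\<close>.\<close>
  have "\<forall>B\<in>\<B>. \<exists>f. B = f +o N" unfolding \<B>_def by blast
  then obtain r where r: "\<And>B. B \<in> \<B> \<Longrightarrow> B = r B +o N" by metis
  have fin: "finite \<B>" unfolding \<B>_def using assms(3) by simp
  have inj: "inj_on r \<B>" by (rule inj_onI) (metis r)
  have "N \<union> F \<subseteq> span (N \<union> r ` \<B>)"
  proof
    fix f assume "f \<in> N \<union> F"
    then show "f \<in> span (N \<union> r ` \<B>)"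
    proof
      assume "f \<in> F"
      then have B: "f +o N \<in> \<B>" unfolding \<B>_def by blast
      then have "f - r (f +o N) \<in> N" using r coset_eq_iff[OF assms(1) sub] by metis
      then have "f - r (f +o N) \<in> span (N \<union> r ` \<B>)" by (simp add: span_base)
      moreover have "r (f +o N) \<in> span (N \<union> r ` \<B>)" using B by (simp add: span_base)
      ultimately have "f - r (f +o N) + r (f +o N) \<in> span (N \<union> r ` \<B>)" by (rule span_add)
      then show ?thesis by simp
    qed (simp add: span_base)
  qed
  then have "span (N \<union> r ` \<B>) = UNIV"
    using assms(4) span_minimal[OF _ subspace_span] by blast
  moreover have "span N = N" using sub by simp
  ultimately have all: "x \<in> {a + b |a b. a \<in> N \<and> b \<in> span (r ` \<B>)}" for x
    using span_Un[of N "r ` \<B>"] by simp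
  have "\<exists>c. A = (\<Sum>B\<in>\<B>. quotient_scale s N (c B) B) + N" if A: "A \<in> quotient_space N" for A
  proof -
    obtain x where x: "A = x +o N" using A unfolding quotient_space_def by blast
    obtain n v where nv: "n \<in> N" "v \<in> span (r ` \<B>)" "x = n + v" using all[of x] by blast
    obtain a where "v = (\<Sum>w\<in>r ` \<B>. s (a w) w)"
      using nv(2) fin by (auto simp: span_finite)
    then have v: "v = (\<Sum>B\<in>\<B>. s (a (r B)) (r B))"
      by (simp add: sum.reindex[OF inj])
    have "A = v +o N" using x nv by (simp add: coset_eq_iff[OF assms(1) sub])
    also have "\<dots> = (\<Sum>B\<in>\<B>. quotient_scale s N ((a \<circ> r) B) B) + N"
      unfolding v using sum_quotient_scale_cosets[OF assms(1) sub fin r, of "a \<circ> r"] by simp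
    finally show ?thesis by blast
  qed
  moreover have "\<B> \<subseteq> quotient_space N" unfolding \<B>_def quotient_space_def by blast
  ultimately show ?thesis using fin unfolding finite_dimensional_quotient_def by blast
qed

section \<open>Balls, bounded functionals and the kernel of the envelope map\<close>

text \<open>If \<open>d\<close> lies in \<open>W\<close>, a small nonzero multiple of a vector
  outside \<open>W\<close> moves it out of \<open>W\<close>.\<close>

lemma proper_subspace_avoids_ball:
  assumes "vector_space s" "quasi_norm s q" "module.subspace s W" "W \<noteq> UNIV" "e > 0"
  shows "\<exists>x. x \<notin> W \<and> q (x - d) < e"
proof -
  interpret vector_space s by fact
  have q: "0 \<le> q x" "q x = 0 \<longleftrightarrow> x = 0" "q (s c x) = norm c * q x" for c x
    using assms(2) unfolding quasi_norm_def by auto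
  show ?thesis
  proof (cases "d \<in> W")
    case False
    then show ?thesis using q(2)[of 0] \<open>e > 0\<close> by (intro exI[of _ d]) auto
  next
    case True
    obtain w where w: "w \<notin> W" using assms(4) by blast
    \<comment> \<open>This makes \<open>q (s c w) = e * q w / (q w + 1)\<close>, strictly below
      \<open>e\<close>.\<close>
    define c :: 'a where "c = of_real (e / (q w + 1))"
    have pos: "q w + 1 > 0" using q(1)[of w] by linarith
    have "norm c = \<bar>e / (q w + 1)\<bar>" unfolding c_def by (rule norm_of_real)
    then have c: "norm c = e / (q w + 1)" "c \<noteq> 0" using pos \<open>e > 0\<close> by auto
    have "s c w \<notin> W"
    proof
      assume "s c w \<in> W"
      then have "s (inverse c) (s c w) \<in> W" by (rule subspace_scale[OF assms(3)])
      then show False using c w by simp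
    qed
    then have "d + s c w \<notin> W"
      using subspace_diff[OF assms(3), of "d + s c w" d] True by auto
    moreover have "q (d + s c w - d) < e"
      using pos \<open>e > 0\<close> by (simp add: q(3) c(1) divide_simps)
    ultimately show ?thesis by blast
  qed
qed

lemma subspace_dual_annihilator:
  assumes "vector_space s"
  shows "module.subspace s (dual_annihilator s q)"
proof -
  interpret vector_space s by fact
  have "subspace {x. f x = 0}" if "f \<in> dual_space s q" for f
  proof -
    have "module_hom s (*) f"
      using that Vector_Spaces.linear.axioms(3) unfolding dual_space_def by blast
    then interpret f: module_hom s "(*)" f .
    show ?thesis by (simp add: subspace_def f.zero f.add f.scale)
  qed
  then have "subspace (\<Inter>f\<in>dual_space s q. {x. f x = 0})"
    by (intro subspace_Inter) blast
  moreover have "dual_annihilator s q = (\<Inter>f\<in>dual_space s q. {x. f x = 0})"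
    unfolding dual_annihilator_def by blast
  ultimately show ?thesis by simp
qed

text \<open>Continuity at \<open>0\<close> bounds \<open>f\<close> by \<open>1\<close> on some
  \<open>q\<close>-ball, and homogeneity carries the bound to all vectors.\<close>

lemma dual_space_bounded:
  assumes "quasi_norm s q" "f \<in> dual_space s q"
  shows "\<exists>C\<ge>0. \<forall>x. norm (f x) \<le> C * q x"
proof -
  have "module_hom s (*) f" and cont: "continuous_map (quasi_topology q) euclidean f"
    using assms(2) Vector_Spaces.linear.axioms(3) unfolding dual_space_def by blast+
  then interpret f: module_hom s "(*)" f by blast
  have q: "0 \<le> q x" "q x = 0 \<longleftrightarrow> x = 0" "q (s c x) = norm c * q x" for c x
    using assms(1) unfolding quasi_norm_def by auto
  have "openin (quasi_topology q) {x \<in> topspace (quasi_topology q). f x \<in> ball 0 1}"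
    using cont by (rule openin_continuous_map_preimage) simp
  then have "\<exists>e>0. \<forall>y. q (y - 0) < e \<longrightarrow> y \<in> {x \<in> topspace (quasi_topology q). f x \<in> ball 0 1}"
    unfolding openin_quasi_topology by (rule bspec) (simp add: f.zero)
  then obtain e where e: "e > 0" "\<And>y. q y < e \<Longrightarrow> norm (f y) < 1" by auto
  have "norm (f x) \<le> 2 / e * q x" for x
  proof (cases "x = 0")
    case False
    then have pos: "q x > 0" using q(1,2)[of x] by linarith
    \<comment> \<open>Rescales \<open>x\<close> to quasi-norm \<open>e / 2\<close>, strictly inside
      the ball.\<close>
    define c :: 'a where "c = of_real (e / (2 * q x))"
    have "norm c = \<bar>e / (2 * q x)\<bar>" unfolding c_def by (rule norm_of_real)
    then have c: "norm c = e / (2 * q x)" using pos e(1) by simp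
    have "q (s c x) < e" using pos e(1) by (simp add: q(3) c)
    then have "norm (f (s c x)) < 1" by (rule e(2))
    then have "e / (2 * q x) * norm (f x) < 1" by (simp add: f.scale norm_mult c)
    then show ?thesis using pos e(1) by (simp add: field_simps)
  qed (use e(1) q(1)[of 0] in \<open>simp add: f.zero\<close>)
  then show ?thesis using e(1) by (intro exI[of _ "2 / e"]) auto
qed

text \<open>For every decomposition of \<open>x\<close> into a finite sum, the triangle inequality
  for scalars gives \<open>norm (f x)\<close> at most \<open>C\<close> times the sum of the
  quasi-norms. The infimum over all decompositions inherits the bound.\<close>

lemma envelope_seminorm_eq_0_imp_annihilator:
  assumes "quasi_norm s q" "envelope_seminorm q x = 0"
  shows "x \<in> dual_annihilator s q"
  unfolding dual_annihilator_def
proof (intro CollectI ballI)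
  fix f assume f: "f \<in> dual_space s q"
  then have "module_hom s (*) f" using Vector_Spaces.linear.axioms(3) unfolding dual_space_def by blast
  then interpret f: module_hom s "(*)" f .
  obtain C where C: "C \<ge> 0" "\<And>x. norm (f x) \<le> C * q x" using dual_space_bounded[OF assms(1) f] by blast
  let ?S = "{(\<Sum>i<n. q (y i)) | (n::nat) y. (\<Sum>i<n. y i) = x}"
  have "(\<Sum>i<1::nat. q x) \<in> ?S" by (intro CollectI exI[of _ 1] exI[of _ "\<lambda>_. x"]) simp
  then have ne: "?S \<noteq> {}" by blast
  \<comment> \<open>Dividing by \<open>C + 1\<close> rather than \<open>C\<close> allows
    \<open>C = 0\<close>.\<close>
  have "norm (f x) / (C + 1) \<le> Inf ?S"
  proof (rule cInf_greatest[OF ne])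
    fix b assume "b \<in> ?S"
    then obtain n :: nat and y where y: "b = (\<Sum>i<n. q (y i))" "(\<Sum>i<n. y i) = x" by blast
    have "norm (f x) = norm (\<Sum>i<n. f (y i))" using y(2) f.sum by metis
    also have "\<dots> \<le> (\<Sum>i<n. C * q (y i))" by (rule sum_norm_le) (rule C(2))
    also have "\<dots> \<le> (\<Sum>i<n. (C + 1) * q (y i))"
      using assms(1) by (intro sum_mono mult_right_mono) (auto simp: quasi_norm_def)
    also have "\<dots> = (C + 1) * b" by (simp add: y(1) sum_distrib_left)
    finally show "norm (f x) / (C + 1) \<le> b" using C(1) by (simp add: field_simps)
  qed
  then have "norm (f x) / (C + 1) \<le> 0" using assms(2) by (simp add: envelope_seminorm_def)
  then show "f x = 0" using C(1) by (simp add: divide_le_0_iff)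
qed

text \<open>Additivity and the isometry on the quotient turn \<open>J x = J y\<close> into the
  vanishing of the envelope seminorm at \<open>x - y\<close>. Conversely, vectors that differ by an
  element of the annihilator have the same coset.\<close>

lemma banach_envelope_map_eq_iff:
  assumes "vector_space s" "quasi_norm s q" "banach_envelope_map s q t J"
  shows "J x = J y \<longleftrightarrow> x - y \<in> dual_annihilator s q"
proof -
  define N where "N = dual_annihilator s q"
  have sub: "module.subspace s N" unfolding N_def by (rule subspace_dual_annihilator[OF assms(1)])
  have module: "module s" using assms(1) by (simp add: module_iff_vector_space)
  note coset = coset_eq_iff[OF assms(1) sub] coset_add[OF assms(1) sub]
  obtain i where i: "quotient_completion s q t i" and J: "\<And>x. J x = i (x +o N)"
    using assms(3) unfolding banach_envelope_map_def N_def by (elim exE conjE) simp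
  have add: "i ((x +o N) + (y +o N)) = i (x +o N) + i (y +o N)" for x y
    using i unfolding quotient_completion_def Let_def N_def[symmetric] quotient_space_def by simp
  have norm: "norm (i (x +o N)) = envelope_seminorm q x" for x
  proof -
    have "0 \<in> N" using sub by (rule module.subspace_0[OF module])
    then have "x \<in> x +o N" by (auto simp: elt_set_plus_def)
    then show ?thesis
      using i unfolding quotient_completion_def Let_def N_def[symmetric] quotient_space_def by simp
  qed
  have "x - y \<in> N" if "J x = J y"
  proof -
    have "i (x +o N) = i ((x - y) +o N) + i (y +o N)"
      using add[of "x - y" y] by (simp add: coset(2))
    then have "i ((x - y) +o N) = 0" using that J by simp
    then have "envelope_seminorm q (x - y) = 0" using norm[of "x - y"] by simp
    then show ?thesis unfolding N_def by (rule envelope_seminorm_eq_0_imp_annihilator[OF assms(2)])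
  qed
  moreover have "J x = J y" if "x - y \<in> N" using that unfolding J coset(1)[symmetric] by simp
  ultimately show ?thesis unfolding N_def by blast
qed

section \<open>Construction of the dense subspace\<close>

lemma dense_subspace_avoiding:
  fixes s :: "'k::real_normed_field \<Rightarrow> 'a::ab_group_add \<Rightarrow> 'a"
  assumes "vector_space s" "quasi_norm s q" "separable_space (quasi_topology q)"
    and "module.subspace s N" "\<not> finite_dimensional_quotient s N"
  shows "\<exists>X. module.subspace s X \<and> quasi_topology q closure_of X = UNIV \<and> X \<inter> N = {0}"
proof -
  interpret vector_space s by fact
  obtain D where D: "countable D" "quasi_topology q closure_of D = UNIV"
    using assms(3) unfolding separable_space_def by auto
  then have "D \<noteq> {}" by auto
  then obtain d :: "nat \<Rightarrow> 'a" where d: "D = range d"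
    using D(1) uncountable_def by blast
  \<comment> \<open>Stage \<open>n\<close> encodes a pair \<open>(i, j)\<close>: the dense point to
    approach and the precision \<open>1 / (j + 1)\<close>. Every pair occurs at some stage.\<close>
  define near where "near n y \<longleftrightarrow>
    q (y - d (fst (prod_decode n))) < inverse (of_nat (Suc (snd (prod_decode n))))" for n y
  have ex: "\<exists>y. y \<notin> span (N \<union> F) \<and> near n y" if "finite F" for F n
    unfolding near_def
    using finite_dimensional_quotient_if_span[OF assms(1,4) that] assms(5)
    by (intro proper_subspace_avoids_ball[OF assms(1,2)] subspace_span) auto
  have "\<exists>x. \<forall>n. x n \<notin> span (N \<union> x ` {..<n}) \<and> near n (x n)"
  proof -
    \<comment> \<open>The condition on the \<open>n\<close>-th vector refers only to earlier values
      of \<open>x\<close>, so the sequence can be chosen recursively.\<close>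
    have "\<exists>x. \<forall>n. (\<lambda>x n y. y \<notin> span (N \<union> x ` {..<n}) \<and> near n y) x n (x n)"
      by (rule dependent_wellorder_choice) (auto intro: ex)
    then show ?thesis by simp
  qed
  then obtain x where x: "\<And>n. x n \<notin> span (N \<union> x ` {..<n})" "\<And>n. near n (x n)" by blast
  have "quasi_topology q closure_of span (range x) = UNIV"
  proof -
    have "\<exists>y \<in> span (range x). y \<in> U" if U: "openin (quasi_topology q) U" "U \<noteq> {}" for U
    proof -
      obtain u where "u \<in> U" using U(2) by blast
      moreover have "u \<in> quasi_topology q closure_of D" using D(2) by simp
      \<comment> \<open>Since \<open>U\<close> is open, it contains a whole ball about
        \<open>d i\<close>, and the vector of a stage \<open>(i, j)\<close> with \<open>j\<close>
        large enough falls into it.\<close>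
      ultimately obtain i where "d i \<in> U" using U(1) unfolding d in_closure_of by blast
      then obtain e where e: "e > 0" "\<And>y. q (y - d i) < e \<Longrightarrow> y \<in> U"
        using U(1) unfolding openin_quasi_topology by blast
      obtain j where "inverse (of_nat (Suc j)) < e" using reals_Archimedean e(1) by blast
      then have "q (x (prod_encode (i, j)) - d i) < e"
        using x(2)[of "prod_encode (i, j)"] by (simp add: near_def)
      then have "x (prod_encode (i, j)) \<in> U" by (rule e(2))
      moreover have "x (prod_encode (i, j)) \<in> span (range x)" by (simp add: span_base)
      ultimately show ?thesis by blast
    qed
    then show ?thesis unfolding set_eq_iff in_closure_of topspace_quasi_topology by blast
  qed
  then show ?thesis using span_Int_subspace_trivial[OF assms(4) x(1)] subspace_span by blast
qed

theorem theorem2p2: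
  fixes s :: "'k::real_normed_field \<Rightarrow> 'a::ab_group_add \<Rightarrow> 'a"
    and q :: "'a \<Rightarrow> real"
    and t :: "'k \<Rightarrow> 'e::banach \<Rightarrow> 'e"
    and J :: "'a \<Rightarrow> 'e"
  assumes "quasi_banach_space s q"
    and "separable_space (quasi_topology q)"
    and "dual_annihilator s q \<noteq> {0}"
    and "\<not> finite_dimensional_quotient s (dual_annihilator s q)"
    and "banach_envelope_map s q t J"
  shows "\<not> inj J \<and>
    (\<exists>X\<^sub>0. module.subspace s X\<^sub>0 \<and> quasi_topology q closure_of X\<^sub>0 = UNIV \<and> inj_on J X\<^sub>0)"
proof -
  have vs: "vector_space s" and qn: "quasi_norm s q"
    using assms(1) unfolding quasi_banach_space_def by auto
  interpret vector_space s by fact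
  let ?N = "dual_annihilator s q"
  have sub: "subspace ?N" by (rule subspace_dual_annihilator[OF vs])
  note J = banach_envelope_map_eq_iff[OF vs qn assms(5)]
  \<comment> \<open>A nonzero vector of the annihilator has the same image under \<open>J\<close> as
    \<open>0\<close>.\<close>
  obtain z where "z \<in> ?N" "z \<noteq> 0" using assms(3) subspace_0[OF sub] by blast
  then have "\<not> inj J" using J[of z 0] by (auto dest: injD)
  moreover obtain X where X: "subspace X" "quasi_topology q closure_of X = UNIV" "X \<inter> ?N = {0}"
    using dense_subspace_avoiding[OF vs qn assms(2) sub assms(4)] by metis
  moreover have "inj_on J X"
  proof (rule inj_onI)
    fix x y assume "x \<in> X" "y \<in> X" "J x = J y"
    then have "x - y \<in> X \<inter> ?N" using J[of x y] subspace_diff[OF X(1), of x y] by simp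
    then show "x = y" using X(3) by simp
  qed
  ultimately show ?thesis by blast
qed

end
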